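(* Let $\varphi$ be a random dynamical system on a non-empty compact metric space $X$ over a memoryless noise space. If $\varphi$ is synchronising, then $\varphi$ is uniquely ergodic.
   Context: **Setting.** $\mathbb{T}^+$ denotes either $\mathbb{N}\cup\{0\}$ or $[0,\infty)$; $(X,d)$ is a compact metric space with Borel $\sigma$-algebra $\mathcal{B}(X)$. A *memoryless noise space* $(\Omega,\mathcal{F},(\mathcal{F}_t)_{t\in\mathbb{T}^+},\mathbb{P},(\theta^t)_{t\in\mathbb{T}^+})$ consists of a probability space $(\Omega,\mathcal{F},\mathbb{P})$, a filtration $(\mathcal{F}_t)$ of sub-$\sigma$-algebras of $\mathcal{F}$ (with $\mathcal{F}_\infty:=\sigma(\mathcal{F}_t:t\in\mathbb{T}^+)$), and $\mathcal{F}$-measurable maps $\theta^t:\Omega\to\Omega$ such that $\theta^0=\mathrm{id}$, $\theta^{s+t}=\theta^s\circ\theta^t$, each $\theta^t$ is measurable from $(\Omega,\mathcal{F}_{s+t})$ to $(\Omega,\mathcal{F}_s)$ for all $s$, $\mathbb{P}$ is invariant under every $\theta^t$, and for every $s$ the $\sigma$-algebras $\mathcal{F}_s$ and $\theta^{-s}\mathcal{F}_\infty:=\{(\theta^s)^{-1}(E):E\in\mathcal{F}_\infty\}$ are independent under $\mathbb{P}$. A *random dynamical system* (RDS) $\varphi$ on $X$ over it is a family of continuous maps $\varphi(t,\omega):X\to X$ ($t\in\mathbb{T}^+$, $\omega\in\Omega$) such that: (a) $(\omega,x)\mapsto\varphi(t,\omega)x$ is $(\mathcal{F}_t\otimes\mathcal{B}(X))$-measurable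 for each $t$; (b) $\varphi(0,\omega)=\mathrm{id}$; (c) $\varphi(s+t,\omega)=\varphi(t,\theta^s\omega)\circ\varphi(s,\omega)$ for all $s,t,\omega$; (d) if $t_n$ decreases to $t$ in $\mathbb{T}^+$ and $x_n\to x$ in $X$, then $\varphi(t_n,\omega)x_n\to\varphi(t,\omega)x$ for all $\omega$; (e) there is a function $\varphi_-:\mathbb{T}^+\times\Omega\times X\to X$ such that if $t_n$ is strictly increasing in $\mathbb{T}^+$ with limit $t\in\mathbb{T}^+$ and $x_n\to x$, then $\varphi(t_n,\omega)x_n\to\varphi_-(t,\omega,x)$ for all $\omega$. **Synchronisation.** $\varphi$ is *synchronising* if for all $x,y\in X$, $\mathbb{P}(\omega: d(\varphi(t,\omega)x,\varphi(t,\omega)y)\to0\text{ as }t\to\infty)=1$. **Unique ergodicity.** Let $\Theta^t:\Omega\times X\to\Omega\times X$, $\Theta^t(\omega,x)=(\theta^t\omega,\varphi(t,\omega)x)$. A probability measure $\rho$ on $X$ is *stationary* if $\mathbb{P}|_{\mathcal{F}_\infty}\otimes\rho$ is invariant under $\Theta^t$ (as a map on $(\Omega\times X,\mathcal{F}_\infty\otimes\mathcal{B}(X))$) for every $t\in\mathbb{T}^+$. $\varphi$ is *uniquely ergodic* if there is exactly one stationary probability measure. *)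

theory Defs
  imports "HOL-Probability.Probability"
begin

text \<open>
  The time set is a set \<open>T\<close> of reals, either \<open>\<nat>\<close> (which contains 0) or \<open>{0..}\<close>.
  Sub-sigma-algebras are represented, as in the library, by measures \<open>F t\<close> of which only
  \<open>space\<close> and \<open>sets\<close> matter.
\<close>

definition F_infty :: "'w measure \<Rightarrow> real set \<Rightarrow> (real \<Rightarrow> 'w measure) \<Rightarrow> 'w measure" where
  "F_infty M T F = sigma (space M) (\<Union>t\<in>T. sets (F t))"

definition invariant_under :: "'a measure \<Rightarrow> ('a \<Rightarrow> 'a) \<Rightarrow> bool" where
  "invariant_under N f \<longleftrightarrow> f \<in> measurable N N \<and> distr N N f = N"

locale memoryless_noise_space = prob_space M
  for M :: "'w measure"
    and T :: "real set"
    and F :: "real \<Rightarrow> 'w measure"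
    and \<theta> :: "real \<Rightarrow> 'w \<Rightarrow> 'w" +
  assumes time_set: "T = \<nat> \<or> T = {0..}"
    and subalgebra_F: "\<And>t. t \<in> T \<Longrightarrow> subalgebra M (F t)"
    and F_mono: "\<And>s t. s \<in> T \<Longrightarrow> t \<in> T \<Longrightarrow> s \<le> t \<Longrightarrow> sets (F s) \<subseteq> sets (F t)"
    and \<theta>_invariant: "\<And>t. t \<in> T \<Longrightarrow> invariant_under M (\<theta> t)"
    and \<theta>_zero: "\<And>\<omega>. \<omega> \<in> space M \<Longrightarrow> \<theta> 0 \<omega> = \<omega>"
    and \<theta>_add: "\<And>s t \<omega>. s \<in> T \<Longrightarrow> t \<in> T \<Longrightarrow> \<omega> \<in> space M \<Longrightarrow> \<theta> (s + t) \<omega> = \<theta> s (\<theta> t \<omega>)"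
    and \<theta>_adapted: "\<And>s t. s \<in> T \<Longrightarrow> t \<in> T \<Longrightarrow> \<theta> t \<in> measurable (F (s + t)) (F s)"
    and memoryless: "\<And>s. s \<in> T \<Longrightarrow>
      indep_set (sets (F s)) {\<theta> s -` E \<inter> space M | E. E \<in> sets (F_infty M T F)}"

locale random_dynamical_system = memoryless_noise_space M T F \<theta>
  for M :: "'w measure"
    and T :: "real set"
    and F :: "real \<Rightarrow> 'w measure"
    and \<theta> :: "real \<Rightarrow> 'w \<Rightarrow> 'w" +
  fixes \<phi> :: "real \<Rightarrow> 'w \<Rightarrow> 'x::metric_space \<Rightarrow> 'x"
  assumes \<phi>_continuous: "\<And>t \<omega>. t \<in> T \<Longrightarrow> \<omega> \<in> space M \<Longrightarrow> continuous_on UNIV (\<phi> t \<omega>)"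
    and \<phi>_measurable: "\<And>t. t \<in> T \<Longrightarrow>
      (\<lambda>(\<omega>, x). \<phi> t \<omega> x) \<in> measurable (F t \<Otimes>\<^sub>M borel) borel"
    and \<phi>_zero: "\<And>\<omega> x. \<omega> \<in> space M \<Longrightarrow> \<phi> 0 \<omega> x = x"
    and \<phi>_cocycle: "\<And>s t \<omega> x. s \<in> T \<Longrightarrow> t \<in> T \<Longrightarrow> \<omega> \<in> space M \<Longrightarrow>
      \<phi> (s + t) \<omega> x = \<phi> t (\<theta> s \<omega>) (\<phi> s \<omega> x)"
    and \<phi>_right_continuous: "\<And>tn t xn x \<omega>. (\<And>n. tn n \<in> T) \<Longrightarrow> t \<in> T \<Longrightarrow>
      decseq tn \<Longrightarrow> tn \<longlonglongrightarrow> t \<Longrightarrow> xn \<longlonglongrightarrow> x \<Longrightarrow> \<omega> \<in> space M \<Longrightarrow>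
      (\<lambda>n. \<phi> (tn n) \<omega> (xn n)) \<longlonglongrightarrow> \<phi> t \<omega> x"
    and \<phi>_left_limits: "\<exists>\<phi>_minus :: real \<Rightarrow> 'w \<Rightarrow> 'x \<Rightarrow> 'x.
      \<forall>tn t xn x. \<forall>\<omega>\<in>space M. (\<forall>n. tn n \<in> T) \<longrightarrow> t \<in> T \<longrightarrow>
      strict_mono tn \<longrightarrow> tn \<longlonglongrightarrow> t \<longrightarrow> xn \<longlonglongrightarrow> x \<longrightarrow>
      (\<lambda>n. \<phi> (tn n) \<omega> (xn n)) \<longlonglongrightarrow> \<phi>_minus t \<omega> x"

text \<open>
  The filter \<open>inf at_top (principal T)\<close> expresses \<open>t \<rightarrow> \<infinity>\<close> with \<open>t\<close> ranging over \<open>T\<close> only.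
\<close>

definition synchronising ::
    "'w measure \<Rightarrow> real set \<Rightarrow> (real \<Rightarrow> 'w \<Rightarrow> 'x::metric_space \<Rightarrow> 'x) \<Rightarrow> bool" where
  "synchronising M T \<phi> \<longleftrightarrow> (\<forall>x y. measure M {\<omega> \<in> space M.
     ((\<lambda>t. dist (\<phi> t \<omega> x) (\<phi> t \<omega> y)) \<longlongrightarrow> 0) (inf at_top (principal T))} = 1)"

definition skew_product ::
    "(real \<Rightarrow> 'w \<Rightarrow> 'w) \<Rightarrow> (real \<Rightarrow> 'w \<Rightarrow> 'x \<Rightarrow> 'x) \<Rightarrow> real \<Rightarrow> 'w \<times> 'x \<Rightarrow> 'w \<times> 'x" where
  "skew_product \<theta> \<phi> t = (\<lambda>(\<omega>, x). (\<theta> t \<omega>, \<phi> t \<omega> x))"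

definition stationary ::
    "'w measure \<Rightarrow> real set \<Rightarrow> (real \<Rightarrow> 'w measure) \<Rightarrow> (real \<Rightarrow> 'w \<Rightarrow> 'w) \<Rightarrow>
     (real \<Rightarrow> 'w \<Rightarrow> 'x::metric_space \<Rightarrow> 'x) \<Rightarrow> 'x measure \<Rightarrow> bool" where
  "stationary M T F \<theta> \<phi> \<rho> \<longleftrightarrow> sets \<rho> = sets borel \<and> prob_space \<rho> \<and>
     (\<forall>t\<in>T. invariant_under (restr_to_subalg M (F_infty M T F) \<Otimes>\<^sub>M \<rho>) (skew_product \<theta> \<phi> t))"

definition uniquely_ergodic ::
    "'w measure \<Rightarrow> real set \<Rightarrow> (real \<Rightarrow> 'w measure) \<Rightarrow> (real \<Rightarrow> 'w \<Rightarrow> 'w) \<Rightarrow>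
     (real \<Rightarrow> 'w \<Rightarrow> 'x::metric_space \<Rightarrow> 'x) \<Rightarrow> bool" where
  "uniquely_ergodic M T F \<theta> \<phi> \<longleftrightarrow> (\<exists>!\<rho>. stationary M T F \<theta> \<phi> \<rho>)"

end

theory Submission imports Defs begin

text \<open>
  Write \<open>P t f x\<close> for the expectation of \<open>f (\<phi> t \<omega> x)\<close>. Independence of past and future makes
  \<open>P\<close> a Feller semigroup, and a measure \<open>\<rho>\<close> is stationary iff \<open>\<integral> P t f \<partial>\<rho> = \<integral> f \<partial>\<rho>\<close> for all
  continuous \<open>f\<close>. Synchronisation gives \<open>P n f x - P n f y \<rightarrow> 0\<close> by dominated convergence.

  Uniqueness: integrating over \<open>y\<close> against a stationary \<open>\<rho>\<close> gives \<open>P n f x \<rightarrow> \<integral> f \<partial>\<rho>\<close>, so \<open>\<rho>\<close> is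
  determined. Existence: let \<open>\<rho>\<close> be a weak limit of the laws of \<open>\<phi> n \<omega> x\<close> along a subsequence.
  No Cesaro averaging is needed, because
  \<open>P n (P t f) x - P n f x\<close> is the expectation of \<open>P n f (\<phi> t \<omega> x) - P n f x\<close> and tends to 0.
\<close>

section \<open>Weak compactness of probability measures on a compact metric space\<close>

text \<open>Total boundedness gives a finite net at each scale 1/(n+1); the union of these nets is
  countable and dense.\<close>

lemma compact_imp_dense_sequence:
  assumes "compact (UNIV :: 'x::metric_space set)"
  obtains a :: "nat \<Rightarrow> 'x::metric_space" where "\<And>x e. 0 < e \<Longrightarrow> \<exists>n. dist x (a n) < e"
proof -
  have "\<exists>k. finite k \<and> (\<forall>x::'x. \<exists>y\<in>k. dist y x < inverse (real (Suc n)))" for n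
  proof -
    have "\<exists>k. finite k \<and> (UNIV :: 'x set) \<subseteq> (\<Union>x\<in>k. ball x (inverse (real (Suc n))))"
      using assms unfolding compact_eq_totally_bounded
      by (metis inverse_positive_iff_positive of_nat_0_less_iff zero_less_Suc)
    then show ?thesis by (simp add: subset_iff)
  qed
  then obtain k :: "nat \<Rightarrow> 'x set"
    where k: "\<And>n. finite (k n)" "\<And>n x. \<exists>y\<in>k n. dist y x < inverse (real (Suc n))"
    by metis
  have K: "countable (\<Union>n. k n)" "(\<Union>n. k n) \<noteq> {}"
    using k by (auto intro: countable_finite, blast)
  show ?thesis
  proof (rule that[of "from_nat_into (\<Union>n. k n)"])
    fix x :: 'x and e :: real
    assume "0 < e"
    then obtain n where n: "inverse (real (Suc n)) < e"
      using reals_Archimedean by blast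
    obtain y where "y \<in> k n" "dist y x < inverse (real (Suc n))"
      using k by blast
    moreover obtain i where "from_nat_into (\<Union>n. k n) i = y"
      using \<open>y \<in> k n\<close> K by (metis UN_I UNIV_I from_nat_into_surj)
    ultimately show "\<exists>i. dist x (from_nat_into (\<Union>n. k n) i) < e"
      using n by (metis dist_commute less_trans)
  qed
qed

section \<open>Compact metric spaces as continuous images of compact sets of reals\<close>

text \<open>Tychonoff's theorem for two-point factors. The digits are real numbers so that they can
  enter a series directly.\<close>

lemma compact_zero_one_sequences: "compact {\<sigma> :: nat \<Rightarrow> real. \<forall>n. \<sigma> n \<in> {0, 1}}"
proof -
  have "compactin (product_topology (\<lambda>_::nat. euclidean :: real topology) UNIV) (PiE UNIV (\<lambda>_. {0, 1}))"
    by (simp add: compactin_PiE)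
  also have "PiE UNIV (\<lambda>_. {0, 1}) = {\<sigma> :: nat \<Rightarrow> real. \<forall>n. \<sigma> n \<in> {0, 1}}"
    by (auto simp: PiE_def)
  finally show ?thesis
    by (simp add: euclidean_product_topology)
qed

text \<open>
  With digits 0 and 1 in base 3, what follows the first differing digit is too small to cancel it.
\<close>
lemma ternary_sum:
  fixes C :: "(nat \<Rightarrow> real) set"
  defines "C \<equiv> {\<sigma>. \<forall>n. \<sigma> n \<in> {0, 1}}"
  shows continuous_on_ternary_sum: "continuous_on C (\<lambda>\<sigma>. \<Sum>n. \<sigma> n * (1/3) ^ n)"
    and inj_on_ternary_sum: "inj_on (\<lambda>\<sigma>. \<Sum>n. \<sigma> n * (1/3) ^ n) C"
proof -
  have bound: "norm (\<sigma> n * (1/3) ^ n) \<le> (1/3::real) ^ n" if "\<sigma> \<in> C" for \<sigma> n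
    using that[unfolded C_def, simplified, rule_format, of n] by (auto simp: abs_mult)
  have summ: "summable (\<lambda>n. \<sigma> n * (1/3::real) ^ n)" if "\<sigma> \<in> C" for \<sigma>
    by (rule summable_comparison_test'[of "\<lambda>n. (1/3::real) ^ n" 0]) (use bound[OF that] in auto)
  have "uniform_limit C (\<lambda>N \<sigma>. \<Sum>n<N. \<sigma> n * (1/3) ^ n) (\<lambda>\<sigma>. \<Sum>n. \<sigma> n * (1/3::real) ^ n) sequentially"
    by (rule Weierstrass_m_test[OF bound]) auto
  then show "continuous_on C (\<lambda>\<sigma>. \<Sum>n. \<sigma> n * (1/3) ^ n)"
  proof (rule uniform_limit_theorem[rotated])
    have "continuous_on C (\<lambda>\<sigma>. \<sigma> n)" for n
      by (rule continuous_on_subset[OF continuous_on_product_coordinates]) simp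
    then show "\<forall>\<^sub>F N in sequentially. continuous_on C (\<lambda>\<sigma>. \<Sum>n<N. \<sigma> n * (1/3::real) ^ n)"
      by (intro always_eventually allI continuous_on_sum continuous_on_mult continuous_on_const)
  qed simp
  show "inj_on (\<lambda>\<sigma>. \<Sum>n. \<sigma> n * (1/3) ^ n) C"
  proof (rule inj_onI, rule ccontr)
    fix \<sigma> \<tau> assume \<sigma>: "\<sigma> \<in> C" and \<tau>: "\<tau> \<in> C"
      and eq: "(\<Sum>n. \<sigma> n * (1/3) ^ n) = (\<Sum>n. \<tau> n * (1/3) ^ n)" and "\<sigma> \<noteq> \<tau>"
    \<comment> \<open>\<open>d\<close> sums to 0 and vanishes before the first differing digit, so
      its term at that digit must be cancelled by the tail.\<close>
    define d where "d = (\<lambda>n. (\<sigma> n - \<tau> n) * (1/3::real) ^ n)"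
    have d_sum: "summable d" "suminf d = 0"
      using summable_diff[OF summ[OF \<sigma>] summ[OF \<tau>]] suminf_diff[OF summ[OF \<sigma>] summ[OF \<tau>]] eq
      by (simp_all add: d_def algebra_simps)
    define m where "m = (LEAST n. \<sigma> n \<noteq> \<tau> n)"
    have "\<exists>n. \<sigma> n \<noteq> \<tau> n"
      using \<open>\<sigma> \<noteq> \<tau>\<close> by auto
    then have m: "\<sigma> m \<noteq> \<tau> m" "\<And>n. n < m \<Longrightarrow> d n = 0"
      unfolding m_def d_def by (rule LeastI_ex) (use not_less_Least in fastforce)
    have abs: "\<bar>\<sigma> n - \<tau> n\<bar> \<le> 1" "\<sigma> n = \<tau> n \<or> \<bar>\<sigma> n - \<tau> n\<bar> = 1" for n
      using \<sigma>[unfolded C_def, simplified, rule_format, of n] \<tau>[unfolded C_def, simplified, rule_format, of n]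
      by auto
    have dm: "\<bar>d m\<bar> = (1/3) ^ m"
      using abs(2)[of m] m(1) by (simp add: d_def abs_mult)
    have "suminf d = (\<Sum>n. d (n + Suc m)) + (\<Sum>n<Suc m. d n)"
      by (rule suminf_split_initial_segment[OF d_sum(1)])
    then have "\<bar>d m\<bar> = \<bar>\<Sum>n. d (n + Suc m)\<bar>"
      using m(2) d_sum(2) by simp
    also have "\<dots> \<le> (\<Sum>n. (1/3) ^ Suc m * (1/3::real) ^ n)"
    proof -
      have le: "norm (d n) \<le> (1/3) ^ n" for n
        using mult_right_mono[OF abs(1)[of n], of "(1/3) ^ n"] by (simp add: d_def abs_mult)
      have le': "norm (d (n + Suc m)) \<le> (1/3) ^ Suc m * (1/3) ^ n" for n
        using le[of "n + Suc m"] by (simp add: power_add mult_ac)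
      have g: "summable (\<lambda>n. (1/3) ^ Suc m * (1/3::real) ^ n)"
        by (intro summable_mult summable_geometric) simp
      have dn: "summable (\<lambda>n. norm (d (n + Suc m)))"
        by (rule summable_comparison_test'[OF g, of 0]) (use le' in simp)
      have "norm (\<Sum>n. d (n + Suc m)) \<le> (\<Sum>n. norm (d (n + Suc m)))"
        by (rule summable_norm[OF dn])
      also have "\<dots> \<le> (\<Sum>n. (1/3) ^ Suc m * (1/3::real) ^ n)"
        by (rule suminf_le[OF le' dn g])
      finally show ?thesis by simp
    qed
    \<comment> \<open>The tail is at most half of the leading term. In base 2 the two could be
      equal, hence base 3.\<close>
    also have "\<dots> = (1/3) ^ Suc m * (3/2)"
      by (subst suminf_mult) (auto simp: suminf_geometric)
    finally show False
      using dm by simp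
  qed
qed

text \<open>
  The surjection is read off the compact graph of all pairs \<open>(\<sigma>, x)\<close> for which the \<open>n\<close>-th digit
  of \<open>\<sigma>\<close> tells on which side of the \<open>n\<close>-th sphere (rational radius, centre in a dense sequence)
  the point \<open>x\<close> lies; points on the sphere may choose either digit.
\<close>
lemma compact_metric_continuous_image_of_real_compact:
  assumes compact: "compact (UNIV :: 'x::metric_space set)"
  obtains K :: "real set" and g :: "real \<Rightarrow> 'x::metric_space"
  where "compact K" "continuous_on K g" "g ` K = UNIV"
proof -
  obtain a :: "nat \<Rightarrow> 'x" where a: "\<And>x e. 0 < e \<Longrightarrow> \<exists>n. dist x (a n) < e"
    using compact_imp_dense_sequence[OF compact] by blast
  \<comment> \<open>A single index runs through all pairs of a centre from the dense sequence and a
    rational radius.\<close>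
  define c where "c n = a (fst (prod_decode n))" for n
  define q where "q n = real_of_rat (from_nat (snd (prod_decode n)))" for n
  define C :: "(nat \<Rightarrow> real) set" where "C = {\<sigma>. \<forall>n. \<sigma> n \<in> {0, 1}}"
  define r :: "(nat \<Rightarrow> real) \<Rightarrow> real" where "r \<sigma> = (\<Sum>n. \<sigma> n * (1/3) ^ n)" for \<sigma>
  \<comment> \<open>Both inequalities are weak, so every condition is closed and \<open>G\<close> is
    a closed subset of a compact product.\<close>
  define G where "G = (C \<times> (UNIV :: 'x set)) \<inter>
    {p. \<forall>n. (dist (snd p) (c n) \<le> q n \<or> fst p n = 1) \<and> (dist (snd p) (c n) \<ge> q n \<or> fst p n = 0)}"
  have coord: "continuous_on UNIV (\<lambda>p :: (nat \<Rightarrow> real) \<times> 'x. fst p n)" for n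
    by (rule continuous_on_compose2[OF continuous_on_product_coordinates continuous_on_fst]) (auto intro: continuous_on_id)
  have "compact (C \<times> (UNIV :: 'x set))"
    unfolding C_def by (rule compact_Times[OF compact_zero_one_sequences compact])
  moreover have "closed {p :: (nat \<Rightarrow> real) \<times> 'x. \<forall>n. (dist (snd p) (c n) \<le> q n \<or> fst p n = 1)
      \<and> (dist (snd p) (c n) \<ge> q n \<or> fst p n = 0)}"
    by (intro closed_Collect_all closed_Collect_conj closed_Collect_disj closed_Collect_le
        closed_Collect_eq coord continuous_on_const continuous_on_dist continuous_on_snd continuous_on_id)
  ultimately have "compact G"
    unfolding G_def by (rule compact_Int_closed)
  have cont: "continuous_on G (r \<circ> fst)"
    unfolding r_def comp_def G_def
    by (rule continuous_on_compose2[OF continuous_on_ternary_sum[folded C_def] continuous_on_fst])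
       (auto intro: continuous_on_id)
  \<comment> \<open>Points with the same digits coincide: otherwise a centre at distance less than
    \<open>dist x y / 2\<close> from \<open>x\<close> admits a rational radius with \<open>x\<close>
    strictly inside and \<open>y\<close> strictly outside, and no digit fits both.\<close>
  have separate: "x = y" if "(\<sigma>, x) \<in> G" "(\<sigma>, y) \<in> G" for \<sigma> x y
  proof (rule ccontr)
    assume "x \<noteq> y"
    then obtain i where i: "dist x (a i) < dist x y / 2"
      using a[of "dist x y / 2"] by auto
    moreover have "dist x y / 2 < dist y (a i)"
      using i dist_triangle2[of x y "a i"] by simp
    ultimately have "dist x (a i) < dist y (a i)" by simp
    then obtain s where s: "dist x (a i) < real_of_rat s" "real_of_rat s < dist y (a i)"
      using of_rat_dense by blast
    define n where "n = prod_encode (i, to_nat s)"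
    have "c n = a i" "q n = real_of_rat s"
      by (simp_all add: c_def q_def n_def)
    then show False
      using that s unfolding G_def by (auto dest!: spec[of _ n])
  qed
  have inj: "inj_on (r \<circ> fst) G"
  proof (rule inj_onI, clarsimp)
    fix \<sigma> x \<tau> y assume *: "(\<sigma>, x) \<in> G" "(\<tau>, y) \<in> G" "r \<sigma> = r \<tau>"
    then have "\<sigma> = \<tau>"
      using inj_on_ternary_sum[folded C_def r_def] by (auto simp: G_def dest: inj_onD)
    with * separate show "\<sigma> = \<tau> \<and> x = y" by blast
  qed
  \<comment> \<open>A continuous injection on a compact set has a continuous inverse, so the point
    depends continuously on its real code.\<close>
  define h where "h = the_inv_into G (r \<circ> fst)"
  have h: "\<And>p. p \<in> G \<Longrightarrow> h ((r \<circ> fst) p) = p"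
    unfolding h_def using inj by (rule the_inv_into_f_f)
  have "continuous_on ((r \<circ> fst) ` G) h"
    using continuous_on_inv[OF cont \<open>compact G\<close>] h by blast
  then have "continuous_on ((r \<circ> fst) ` G) (snd \<circ> h)"
    unfolding comp_def by (rule continuous_on_snd)
  moreover have "compact ((r \<circ> fst) ` G)"
    by (rule compact_continuous_image[OF cont \<open>compact G\<close>])
  moreover have "(snd \<circ> h) ` (r \<circ> fst) ` G = UNIV"
  proof -
    have "x \<in> snd ` G" for x
    proof
      \<comment> \<open>Every point has a code: digit 0 in the closed ball and digit 1 outside
        it.\<close>
      show "(\<lambda>n. if dist x (c n) \<le> q n then 0 else 1, x) \<in> G"
        by (auto simp: G_def C_def)
    qed simp
    moreover have "(snd \<circ> h) ` (r \<circ> fst) ` G = snd ` G"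
      using h by (force simp: image_image)
    ultimately show ?thesis by auto
  qed
  ultimately show ?thesis
    by (intro that)
qed

section \<open>Weak limits through Helly selection\<close>

text \<open>This is the first index within \<open>e\<close>, not that of a closest point. It is a
  natural number, so every function of it is Borel, however irregular.\<close>

lemma measurable_nearest_index:
  fixes a :: "nat \<Rightarrow> 'x::metric_space"
  shows "(\<lambda>x. LEAST i. dist x (a i) < e) \<in> measurable borel (count_space UNIV)"
proof (rule measurable_Least)
  fix i
  have "{x. dist x (a i) < e} \<in> sets borel"
    by (simp add: borel_open open_Collect_less continuous_on_dist continuous_on_id continuous_on_const)
  then show "Measurable.pred borel (\<lambda>x. dist x (a i) < e)"
    by (simp add: pred_def)
qed

text \<open>
  The measures are lifted, up to \<open>1 / n\<close>, along a continuous surjection onto the space from a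
  compact set of reals, where Helly's selection theorem applies.
\<close>
theorem compact_metric_weak_subsequence:
  fixes \<mu> :: "nat \<Rightarrow> 'x::metric_space measure"
  assumes compact: "compact (UNIV :: 'x set)"
    and prob: "\<And>n. prob_space (\<mu> n)" and sets: "\<And>n. sets (\<mu> n) = sets borel"
  obtains s \<rho> where "strict_mono s" "prob_space \<rho>" "sets \<rho> = sets borel"
    "\<And>f :: 'x \<Rightarrow> real. continuous_on UNIV f \<Longrightarrow> (\<lambda>n. \<integral>x. f x \<partial>\<mu> (s n)) \<longlonglongrightarrow> (\<integral>x. f x \<partial>\<rho>)"
proof -
  obtain K :: "real set" and g :: "real \<Rightarrow> 'x"
    where K: "compact K" and g: "continuous_on K g" and surj: "g ` K = UNIV"
    using compact_metric_continuous_image_of_real_compact[OF compact] by blast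
  have closed: "closed K" and nonempty: "K \<noteq> {}"
    using compact_imp_closed[OF K] surj by auto
  obtain a :: "nat \<Rightarrow> 'x" where a: "\<And>x e. 0 < e \<Longrightarrow> \<exists>n. dist x (a n) < e"
    using compact_imp_dense_sequence[OF compact] by blast
  \<comment> \<open>\<open>c\<close> is an arbitrary right inverse of \<open>g\<close> and may fail
    to be measurable. Hence \<open>h n\<close> applies it only to points of the dense sequence,
    which makes \<open>h n\<close> measurable at the cost of an error below 1/(n+1).\<close>
  define c where "c = inv_into K g"
  have c: "c x \<in> K" "g (c x) = x" for x
    by (simp_all add: c_def surj inv_into_into f_inv_into_f)
  define h where "h n x = c (a (LEAST i. dist x (a i) < inverse (real (Suc n))))" for n x
  have h_K: "h n x \<in> K" for n x
    by (simp add: h_def c)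
  have h_dist: "dist x (g (h n x)) < inverse (real (Suc n))" for n x
    unfolding h_def c by (rule LeastI_ex) (intro a, simp)
  have h_meas: "h n \<in> borel_measurable (\<mu> m)" for n m
  proof -
    have "(\<lambda>i. c (a i)) \<circ> (\<lambda>x. LEAST i. dist x (a i) < inverse (real (Suc n))) \<in> borel_measurable borel"
      by (rule measurable_comp[OF measurable_nearest_index]) simp
    then show ?thesis
      by (simp add: h_def[abs_def] comp_def cong: measurable_cong_sets[OF sets refl])
  qed
  define \<nu> where "\<nu> n = distr (\<mu> n) borel (h n)" for n
  have \<nu>: "real_distribution (\<nu> n)" for n
    unfolding \<nu>_def by (rule prob_space.real_distribution_distr[OF prob h_meas])
  obtain B where B: "\<And>u. u \<in> K \<Longrightarrow> \<bar>u\<bar> \<le> B"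
    using compact_imp_bounded[OF K] by (auto simp: bounded_iff)
  have "tight \<nu>"
    unfolding tight_def
  proof (intro conjI allI impI)
    fix e :: real assume "0 < e"
    \<comment> \<open>The lifted measures all live on \<open>K\<close>, which is bounded by
      \<open>B\<close>. The open left end is lowered by 1 so that \<open>-B\<close> is included and
      the interval is nondegenerate even for \<open>B = 0\<close>.\<close>
    have "measure (\<nu> n) {-B - 1<..B} = 1" for n
    proof -
      have "h n -` {-B - 1<..B} \<inter> space (\<mu> n) = space (\<mu> n)"
      proof -
        have "h n x \<in> {-B - 1<..B}" for x
          using B[OF h_K[of n x]] by (simp add: abs_le_iff)
        then show ?thesis by blast
      qed
      then show ?thesis
        using prob_space.prob_space[OF prob] by (simp add: \<nu>_def measure_distr h_meas)
    qed
    moreover have "-B - 1 < B"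
      using B[OF h_K[of 0 "a 0"]] by simp
    ultimately show "\<exists>a b. a < b \<and> (\<forall>n. measure (\<nu> n) {a<..b} > 1 - e)"
      using \<open>0 < e\<close> by (intro exI[of _ "-B - 1"] exI[of _ B]) auto
  qed (rule \<nu>)
  then obtain s \<kappa> where s: "strict_mono s" and "real_distribution \<kappa>" and weak: "weak_conv_m (\<nu> \<circ> s) \<kappa>"
    using tight_imp_convergent_subsubsequence[of \<nu> id] by (auto simp: strict_mono_def)
  interpret \<kappa>: real_distribution \<kappa> by fact
  have conv: "(\<lambda>n. \<integral>x. F (h (s n) x) \<partial>\<mu> (s n)) \<longlonglongrightarrow> (\<integral>u. F u \<partial>\<kappa>)"
    if "continuous_on UNIV F" "\<And>u. norm (F u) \<le> b" for F :: "real \<Rightarrow> real" and b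
  proof -
    have "isCont F u" for u
      using that(1) by (simp add: continuous_on_eq_continuous_at)
    then have "(\<lambda>n. integral\<^sup>L ((\<nu> \<circ> s) n) F) \<longlonglongrightarrow> integral\<^sup>L \<kappa> F"
      using \<nu> that(2) weak \<open>real_distribution \<kappa>\<close>
      by (intro weak_conv_imp_integral_bdd_continuous_conv[of "\<nu> \<circ> s" \<kappa> F b]) auto
    moreover have "F \<in> borel_measurable borel"
      using that(1) by (rule borel_measurable_continuous_onI)
    ultimately show ?thesis
      by (simp add: \<nu>_def integral_distr h_meas)
  qed
  \<comment> \<open>The truncated distance to \<open>K\<close> is bounded, continuous and zero along
    the lifts, so its integral against the weak limit is 0. Being nonnegative, it vanishes almost
    everywhere, and \<open>K\<close> is closed.\<close>
  have AE_K: "AE u in \<kappa>. u \<in> K"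
  proof -
    define F where "F u = min 1 (infdist u K)" for u
    have "continuous_on UNIV F"
      unfolding F_def by (intro continuous_on_min continuous_on_infdist continuous_on_const continuous_on_id)
    moreover have "norm (F u) \<le> 1" "0 \<le> F u" for u
      using infdist_nonneg[of u K] by (simp_all add: F_def min_def)
    ultimately have F: "continuous_on UNIV F" "\<And>u. norm (F u) \<le> 1" "\<And>u. 0 \<le> F u"
      by simp_all
    have "F (h n x) = 0" for n x
      using h_K by (simp add: F_def)
    then have "(\<integral>u. F u \<partial>\<kappa>) = 0"
      using conv[OF F(1,2)] by (simp add: LIMSEQ_const_iff)
    moreover have meas: "F \<in> borel_measurable \<kappa>"
      using borel_measurable_continuous_onI[OF F(1)] by simp
    moreover have "integrable \<kappa> F"
      by (rule \<kappa>.integrable_const_bound[of _ 1]) (use F meas in auto)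
    ultimately have "AE u in \<kappa>. F u = 0"
      using F(3) by (subst (asm) integral_nonneg_eq_0_iff_AE) auto
    then show ?thesis
    proof eventually_elim
      fix u assume "F u = 0"
      then have "infdist u K = 0"
        by (simp add: F_def min_def split: if_splits)
      then show "u \<in> K"
        using in_closed_iff_infdist_zero[OF closed nonempty] by simp
    qed
  qed
  \<comment> \<open>The complement of \<open>K\<close> is null for \<open>\<kappa>\<close>; a
    constant value there gives a total measurable map.\<close>
  define g' where "g' u = (if u \<in> K then g u else g (c (a 0)))" for u
  have g'_meas: "g' \<in> measurable \<kappa> borel"
    using borel_measurable_continuous_on_if[OF borel_closed[OF closed] g continuous_on_const, of "g (c (a 0))"]
    by (simp add: g'_def[abs_def])
  define \<rho> where "\<rho> = distr \<kappa> borel g'"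
  show ?thesis
  proof (rule that[of s \<rho>])
    show "prob_space \<rho>"
      unfolding \<rho>_def by (rule \<kappa>.prob_space_distr[OF g'_meas])
    show "sets \<rho> = sets borel" by (simp add: \<rho>_def)
    fix f :: "'x \<Rightarrow> real" assume f: "continuous_on UNIV f"
    have f_meas: "f \<in> borel_measurable borel"
      using f by (rule borel_measurable_continuous_onI)
    obtain b where b: "\<And>x. norm (f x) \<le> b"
      using compact_imp_bounded[OF compact_continuous_image[OF f compact]] by (auto simp: bounded_iff)
    have b0: "0 \<le> b"
      using b[of "a 0"] by (rule order_trans[OF norm_ge_zero])
    \<comment> \<open>\<open>conv\<close> concerns functions on the whole line, so Tietze's theorem
      extends \<open>f \<circ> g\<close> from \<open>K\<close> with the same bound.\<close>
    obtain F where F: "continuous_on UNIV F" "\<And>u. u \<in> K \<Longrightarrow> F u = f (g u)" "\<And>u. norm (F u) \<le> b"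
    proof (rule Tietze[of K "f \<circ> g" UNIV b])
      show "continuous_on K (f \<circ> g)"
        using continuous_on_compose[OF g continuous_on_subset[OF f]] by simp
    qed (use b b0 closed in auto)
    have "(\<integral>x. f x \<partial>\<rho>) = (\<integral>u. f (g' u) \<partial>\<kappa>)"
      unfolding \<rho>_def by (rule integral_distr[OF g'_meas f_meas])
    also have "\<dots> = (\<integral>u. F u \<partial>\<kappa>)"
    proof (rule integral_cong_AE)
      show "(\<lambda>u. f (g' u)) \<in> borel_measurable \<kappa>"
        by (rule measurable_compose[OF g'_meas f_meas])
      show "F \<in> borel_measurable \<kappa>"
        using borel_measurable_continuous_onI[OF F(1)] by simp
      show "AE u in \<kappa>. f (g' u) = F u"
        using AE_K by eventually_elim (simp add: g'_def F)
    qed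
    finally have lim: "(\<lambda>n. \<integral>x. f (g (h (s n) x)) \<partial>\<mu> (s n)) \<longlonglongrightarrow> (\<integral>x. f x \<partial>\<rho>)"
      using conv[OF F(1,3)] F(2) h_K by simp
    \<comment> \<open>Lifting and projecting back moves each point by less than 1/(n+1), so uniform
      continuity of \<open>f\<close> makes the error in the integral vanish.\<close>
    have "(\<lambda>n. (\<integral>x. f (g (h n x)) \<partial>\<mu> n) - (\<integral>x. f x \<partial>\<mu> n)) \<longlonglongrightarrow> 0"
    proof (rule LIMSEQ_I)
      fix e :: real assume "0 < e"
      moreover have "uniformly_continuous_on UNIV f"
        by (rule compact_uniformly_continuous[OF f compact])
      ultimately obtain d where d: "0 < d" "\<And>x y. dist x y < d \<Longrightarrow> dist (f x) (f y) < e / 2"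
        unfolding uniformly_continuous_on_def by (auto elim!: allE[of _ "e / 2"] simp: dist_commute)
      obtain N where N: "inverse (real (Suc N)) < d"
        using reals_Archimedean[OF d(1)] by blast
      have "norm ((\<integral>x. f (g (h n x)) \<partial>\<mu> n) - (\<integral>x. f x \<partial>\<mu> n) - 0) < e" if "N \<le> n" for n
      proof -
        interpret \<mu>: prob_space "\<mu> n" by (rule prob)
        have m1: "(\<lambda>x. f (g (h n x))) \<in> borel_measurable (\<mu> n)"
        proof -
          have "F \<in> borel_measurable borel"
            by (rule borel_measurable_continuous_onI[OF F(1)])
          from measurable_compose[OF h_meas this] show ?thesis
            using F(2)[OF h_K] by simp
        qed
        have m2: "f \<in> borel_measurable (\<mu> n)"
          using f_meas by (simp cong: measurable_cong_sets[OF sets refl])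
        have i1: "integrable (\<mu> n) (\<lambda>x. f (g (h n x)))" and i2: "integrable (\<mu> n) f"
          by (rule \<mu>.integrable_const_bound[of _ b]; use b m1 m2 in simp)+
        have "\<bar>f (g (h n x)) - f x\<bar> \<le> e / 2" for x
        proof -
          have "inverse (real (Suc n)) \<le> inverse (real (Suc N))"
            using that by simp
          then have "dist (g (h n x)) x < d"
            using less_trans[OF less_le_trans[OF h_dist[of x n]] N] by (simp add: dist_commute)
          from d(2)[OF this] show ?thesis
            by (simp add: dist_real_def)
        qed
        then have "\<bar>\<integral>x. f (g (h n x)) - f x \<partial>\<mu> n\<bar> \<le> (\<integral>x. e / 2 \<partial>\<mu> n)"
          using i1 i2 by (intro order_trans[OF integral_abs_bound] integral_mono) auto
        then show ?thesis
          using \<open>0 < e\<close> i1 i2 \<mu>.prob_space by simp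
      qed
      then show "\<exists>N. \<forall>n\<ge>N. norm ((\<integral>x. f (g (h n x)) \<partial>\<mu> n) - (\<integral>x. f x \<partial>\<mu> n) - 0) < e"
        by blast
    qed
    from tendsto_diff[OF lim LIMSEQ_subseq_LIMSEQ[OF this s]]
    show "(\<lambda>n. \<integral>x. f x \<partial>\<mu> (s n)) \<longlonglongrightarrow> (\<integral>x. f x \<partial>\<rho>)"
      by (simp add: comp_def)
  qed (rule s)
qed

section \<open>Measures are determined by continuous functions\<close>

text \<open>The indicator of a closed set is a pointwise limit of continuous functions with values
  in [0, 1], and the closed sets form an intersection-stable generator.\<close>

lemma measure_eqI_continuous:
  fixes \<mu> \<nu> :: "'x::metric_space measure"
  assumes "prob_space \<mu>" "prob_space \<nu>" and sets: "sets \<mu> = sets borel" "sets \<nu> = sets borel"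
    and eq: "\<And>f :: 'x \<Rightarrow> real. continuous_on UNIV f \<Longrightarrow> (\<And>x. 0 \<le> f x) \<Longrightarrow> (\<And>x. f x \<le> 1) \<Longrightarrow>
      (\<integral>x. f x \<partial>\<mu>) = (\<integral>x. f x \<partial>\<nu>)"
  shows "\<mu> = \<nu>"
proof -
  interpret \<mu>: prob_space \<mu> by fact
  interpret \<nu>: prob_space \<nu> by fact
  have closed_eq: "measure \<mu> A = measure \<nu> A" if A: "closed A" for A
  \<comment> \<open>\<open>infdist\<close> to the empty set is 0 by convention, so there the
    approximants below would be constantly 1.\<close>
  proof (cases "A = {}")
    case False
    define f where "f n x = max 0 (1 - real n * infdist x A)" for n x
    have cont: "continuous_on UNIV (f n)" for n
      unfolding f_def by (intro continuous_on_max continuous_on_diff continuous_on_mult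
        continuous_on_infdist continuous_on_const continuous_on_id)
    have range: "0 \<le> f n x" "f n x \<le> 1" for n x
      by (auto simp: f_def infdist_nonneg)
    have lim: "(\<lambda>n. f n x) \<longlonglongrightarrow> indicator A x" for x
    proof (cases "x \<in> A")
      case True
      then show ?thesis by (simp add: f_def)
    next
      case x: False
      then have pos: "0 < infdist x A"
        using in_closed_iff_infdist_zero[OF A False] infdist_nonneg[of x A] by (metis less_eq_real_def)
      obtain N where "1 < real N * infdist x A"
        using reals_Archimedean3[OF pos] by blast
      moreover have "real N * infdist x A \<le> real n * infdist x A" if "N \<le> n" for n
        using that by (intro mult_right_mono infdist_nonneg) simp
      ultimately have "f n x = 0" if "N \<le> n" for n
        using that by (fastforce simp: f_def)
      then show ?thesis
        using x by (auto intro!: tendsto_eventually eventually_sequentiallyI)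
    qed
    have "(\<lambda>n. \<integral>x. f n x \<partial>N) \<longlonglongrightarrow> measure N A" if "prob_space N" "sets N = sets borel" for N
    proof -
      interpret N: prob_space N by fact
      have "(\<lambda>n. \<integral>x. f n x \<partial>N) \<longlonglongrightarrow> (\<integral>x. indicator A x \<partial>N)"
      proof (rule integral_dominated_convergence[where w="\<lambda>_. 1"])
        show "f n \<in> borel_measurable N" for n
          using borel_measurable_continuous_onI[OF cont] by (simp cong: measurable_cong_sets[OF that(2) refl])
        show "indicator A \<in> borel_measurable N"
          using A that(2) by (intro borel_measurable_indicator) (simp add: borel_closed)
      qed (use lim range in auto)
      then show ?thesis
        using sets_eq_imp_space_eq[OF that(2)] by simp
    qed
    from this[OF assms(1) sets(1)] this[OF assms(2) sets(2)] show ?thesis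
      using eq[OF cont range] by (simp add: LIMSEQ_unique)
  qed simp
  show ?thesis
  proof (rule measure_eqI_generator_eq[where E="Collect closed" and \<Omega>=UNIV and A="\<lambda>_. UNIV"])
    show "Int_stable (Collect closed)"
      by (auto simp: Int_stable_def)
    show "sets \<mu> = sigma_sets UNIV (Collect closed)" "sets \<nu> = sigma_sets UNIV (Collect closed)"
      unfolding sets borel_eq_closed by simp_all
    show "emeasure \<mu> A = emeasure \<nu> A" if "A \<in> Collect closed" for A
      using closed_eq that by (simp add: \<mu>.emeasure_eq_measure \<nu>.emeasure_eq_measure)
  qed auto
qed

section \<open>Independence of past and future\<close>

context memoryless_noise_space
begin

abbreviation M_infty :: "'w measure" where
  "M_infty \<equiv> restr_to_subalg M (F_infty M T F)"

lemma T_add: "s \<in> T \<Longrightarrow> t \<in> T \<Longrightarrow> s + t \<in> T"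
  and of_nat_in_T: "real n \<in> T"
  using time_set by auto

lemma F_infty_generators: "(\<Union>t\<in>T. sets (F t)) \<subseteq> Pow (space M)"
proof (rule UN_least)
  fix t assume "t \<in> T"
  then show "sets (F t) \<subseteq> Pow (space M)"
    using subalgebra_F[of t] sets.space_closed[of "F t"] by (simp add: subalgebra_def)
qed

lemma sets_F_infty: "sets (F_infty M T F) = sigma_sets (space M) (\<Union>t\<in>T. sets (F t))"
  unfolding F_infty_def by (rule sets_measure_of[OF F_infty_generators])

lemma subalgebra_F_infty: "subalgebra M (F_infty M T F)"
  unfolding subalgebra_def
proof
  show "space (F_infty M T F) = space M"
    unfolding F_infty_def by (rule space_measure_of[OF F_infty_generators])
  show "sets (F_infty M T F) \<subseteq> sets M"
    unfolding sets_F_infty using subalgebra_F by (intro sets.sigma_sets_subset) (auto simp: subalgebra_def)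
qed

lemma sets_M_infty: "sets M_infty = sets (F_infty M T F)"
  by (rule sets_restr_to_subalg[OF subalgebra_F_infty])

lemma space_M_infty: "space M_infty = space M"
  by (rule space_restr_to_subalg)

lemma sets_F_subset_M_infty: "t \<in> T \<Longrightarrow> sets (F t) \<subseteq> sets M_infty"
  unfolding sets_M_infty sets_F_infty by auto

lemma measurable_F_M: "t \<in> T \<Longrightarrow> f \<in> measurable (F t) N \<Longrightarrow> f \<in> measurable M N"
  by (rule measurable_from_subalg[OF subalgebra_F])

lemma measurable_F_M_infty:
  assumes "t \<in> T" "f \<in> measurable (F t) N"
  shows "f \<in> measurable M_infty N"
proof (rule measurable_from_subalg[OF _ assms(2)])
  show "subalgebra M_infty (F t)"
    using subalgebra_F[OF assms(1)] sets_F_subset_M_infty[OF assms(1)]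
    by (simp add: subalgebra_def space_M_infty)
qed

lemma prob_space_M_infty: "prob_space M_infty"
  by (rule prob_space_restr_to_subalg[OF subalgebra_F_infty prob_space_axioms])

lemma \<theta>_measurable_M: "t \<in> T \<Longrightarrow> \<theta> t \<in> measurable M M"
  using \<theta>_invariant by (simp add: invariant_under_def)

text \<open>It suffices to check generators: by adaptedness the preimage of an event of
  \<open>F s\<close> lies in \<open>F (s + t)\<close>.\<close>

lemma \<theta>_measurable_M_infty:
  assumes "t \<in> T"
  shows "\<theta> t \<in> measurable M_infty M_infty"
proof (rule measurable_sigma_sets)
  show "sets M_infty = sigma_sets (space M) (\<Union>t\<in>T. sets (F t))"
    by (simp add: sets_M_infty sets_F_infty)
  show "(\<Union>t\<in>T. sets (F t)) \<subseteq> Pow (space M)"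
    by (rule F_infty_generators)
  show "\<theta> t \<in> space M_infty \<rightarrow> space M"
    using measurable_space[OF \<theta>_measurable_M[OF assms]] by (simp add: space_M_infty)
  fix E assume "E \<in> (\<Union>t\<in>T. sets (F t))"
  then obtain s where s: "s \<in> T" "E \<in> sets (F s)" by blast
  have "\<theta> t -` E \<inter> space (F (s + t)) \<in> sets (F (s + t))"
    using \<theta>_adapted[OF s(1) assms] s(2) by (rule measurable_sets)
  moreover have "space (F (s + t)) = space M_infty"
    using subalgebra_F[OF T_add[OF s(1) assms]] by (simp add: subalgebra_def space_M_infty)
  ultimately show "\<theta> t -` E \<inter> space M_infty \<in> sets M_infty"
    using sets_F_subset_M_infty[OF T_add[OF s(1) assms]] by auto
qed

lemma \<theta>_measurable_M_M_infty: "t \<in> T \<Longrightarrow> \<theta> t \<in> measurable M M_infty"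
  using measurable_in_subalg'[OF subalgebra_F_infty \<theta>_measurable_M_infty]
  by (rule measurable_from_subalg[OF subalgebra_F_infty])

lemma emeasure_M_infty: "A \<in> sets M_infty \<Longrightarrow> emeasure M_infty A = emeasure M A"
  using emeasure_restr_to_subalg[OF subalgebra_F_infty] by (simp add: sets_M_infty)

lemma sets_M_infty_M: "A \<in> sets M_infty \<Longrightarrow> A \<in> sets M"
  using subalgebra_F_infty by (auto simp: sets_M_infty subalgebra_def)

lemma emeasure_\<theta>_vimage:
  assumes t: "t \<in> T" and A: "A \<in> sets M_infty"
  shows "emeasure M (\<theta> t -` A \<inter> space M) = emeasure M_infty A"
proof -
  have "emeasure (distr M M (\<theta> t)) A = emeasure M A"
    using \<theta>_invariant[OF t] by (simp add: invariant_under_def)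
  then show ?thesis
    using A by (simp add: emeasure_distr[OF \<theta>_measurable_M[OF t]] sets_M_infty_M emeasure_M_infty)
qed

text \<open>Memorylessness factors off the probability of the shifted event, and invariance of the
  measure removes the shift.\<close>

lemma prob_past_future:
  assumes t: "t \<in> T" and A: "A \<in> sets (F t)" and E: "E \<in> sets M_infty"
  shows "emeasure M (A \<inter> (\<theta> t -` E \<inter> space M)) = emeasure M A * emeasure M_infty E"
proof -
  have "prob (A \<inter> (\<theta> t -` E \<inter> space M)) = prob A * prob (\<theta> t -` E \<inter> space M)"
    using A E by (intro indep_setD[OF memoryless[OF t]]) (auto simp: sets_M_infty)
  then show ?thesis
    by (simp add: emeasure_eq_measure ennreal_mult flip: emeasure_\<theta>_vimage[OF t E])
qed

text \<open>Rectangles determine a product measure, and on them this is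
  \<open>prob_past_future\<close>. In this form independence allows Fubini over a past variable and
  fresh noise.\<close>

lemma distr_past_future:
  assumes t: "t \<in> T" and Y: "Y \<in> measurable (F t) N"
  shows "distr M (N \<Otimes>\<^sub>M M_infty) (\<lambda>\<omega>. (Y \<omega>, \<theta> t \<omega>)) = distr M N Y \<Otimes>\<^sub>M M_infty"
proof (rule pair_measure_eqI[symmetric])
  have Y_M: "Y \<in> measurable M N"
    by (rule measurable_F_M[OF t Y])
  have pair: "(\<lambda>\<omega>. (Y \<omega>, \<theta> t \<omega>)) \<in> measurable M (N \<Otimes>\<^sub>M M_infty)"
    by (rule measurable_Pair[OF Y_M \<theta>_measurable_M_M_infty[OF t]])
  show "sigma_finite_measure (distr M N Y)"
    by (rule prob_space_imp_sigma_finite[OF prob_space_distr[OF Y_M]])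
  show "sigma_finite_measure M_infty"
    by (rule prob_space_imp_sigma_finite[OF prob_space_M_infty])
  show "sets (distr M N Y \<Otimes>\<^sub>M M_infty) = sets (distr M (N \<Otimes>\<^sub>M M_infty) (\<lambda>\<omega>. (Y \<omega>, \<theta> t \<omega>)))"
    by (simp cong: sets_pair_measure_cong)
  fix A E assume A: "A \<in> sets (distr M N Y)" and E: "E \<in> sets M_infty"
  have "Y -` A \<inter> space M \<in> sets (F t)"
    using measurable_sets[OF Y, of A] A subalgebra_F[OF t] by (simp add: subalgebra_def)
  moreover have "(\<lambda>\<omega>. (Y \<omega>, \<theta> t \<omega>)) -` (A \<times> E) \<inter> space M = (Y -` A \<inter> space M) \<inter> (\<theta> t -` E \<inter> space M)"
    by auto
  ultimately show "emeasure (distr M N Y) A * emeasure M_infty E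
      = emeasure (distr M (N \<Otimes>\<^sub>M M_infty) (\<lambda>\<omega>. (Y \<omega>, \<theta> t \<omega>))) (A \<times> E)"
    using A E by (simp add: emeasure_distr[OF Y_M] emeasure_distr[OF pair] prob_past_future[OF t])
qed

end

section \<open>Transition operators and stationary measures\<close>

context random_dynamical_system
begin

lemma \<phi>_measurable_F: "t \<in> T \<Longrightarrow> (\<lambda>\<omega>. \<phi> t \<omega> x) \<in> measurable (F t) borel"
  using measurable_compose[OF measurable_Pair2'[of x borel "F t"] \<phi>_measurable] by simp

lemma \<phi>_measurable_M: "t \<in> T \<Longrightarrow> (\<lambda>\<omega>. \<phi> t \<omega> x) \<in> measurable M borel"
  by (rule measurable_F_M[OF _ \<phi>_measurable_F])

text \<open>The identity is measurable from \<open>M_infty\<close> to \<open>F t\<close>, so all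
  times can be treated on one product space.\<close>

lemma \<phi>_measurable_pair:
  assumes "t \<in> T"
  shows "(\<lambda>p. \<phi> t (fst p) (snd p)) \<in> measurable (M_infty \<Otimes>\<^sub>M borel) borel"
proof -
  have "(\<lambda>p. (fst p, snd p)) \<in> measurable (M_infty \<Otimes>\<^sub>M (borel :: 'x measure)) (F t \<Otimes>\<^sub>M borel)"
  proof (rule measurable_Pair)
    have "(\<lambda>\<omega>. \<omega>) \<in> measurable M_infty (F t)"
      by (rule measurable_F_M_infty[OF assms]) simp
    then show "fst \<in> measurable (M_infty \<Otimes>\<^sub>M (borel :: 'x measure)) (F t)"
      using measurable_compose[OF measurable_fst] by blast
  qed simp
  from measurable_compose[OF this \<phi>_measurable[OF assms]] show ?thesis
    by (simp add: case_prod_beta)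
qed

definition transition :: "real \<Rightarrow> ('x \<Rightarrow> real) \<Rightarrow> 'x \<Rightarrow> real" where
  "transition t f x = (\<integral>\<omega>. f (\<phi> t \<omega> x) \<partial>M)"

lemma continuous_measurable_\<phi>:
  assumes "t \<in> T" "continuous_on UNIV f"
  shows "(\<lambda>\<omega>. f (\<phi> t \<omega> x) :: real) \<in> borel_measurable (F t)"
  by (rule measurable_compose[OF \<phi>_measurable_F[OF assms(1)] borel_measurable_continuous_onI[OF assms(2)]])

lemma transition_bounded:
  assumes "t \<in> T" "continuous_on UNIV f" "\<And>x. \<bar>f x\<bar> \<le> b"
  shows "\<bar>transition t f x\<bar> \<le> b"
proof -
  have "integrable M (\<lambda>\<omega>. f (\<phi> t \<omega> x))"
    using assms measurable_F_M[OF assms(1) continuous_measurable_\<phi>[OF assms(1,2)]]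
    by (intro integrable_const_bound[of _ b]) auto
  then have "\<bar>transition t f x\<bar> \<le> (\<integral>\<omega>. b \<partial>M)"
    unfolding transition_def using assms(3)
    by (intro order_trans[OF integral_abs_bound] integral_mono) auto
  then show ?thesis by (simp add: prob_space)
qed

text \<open>The Feller property: continuity for each noise path passes to the expectation by
  dominated convergence with the constant \<open>b\<close>.\<close>

lemma transition_continuous:
  assumes "t \<in> T" "continuous_on UNIV f" "\<And>x. \<bar>f x\<bar> \<le> b"
  shows "continuous_on UNIV (transition t f)"
proof (rule continuous_on_sequentiallyI)
  fix u :: "nat \<Rightarrow> 'x" and x assume u: "u \<longlonglongrightarrow> x"
  show "(\<lambda>n. transition t f (u n)) \<longlonglongrightarrow> transition t f x"
    unfolding transition_def
  proof (rule integral_dominated_convergence[where w="\<lambda>_. b"])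
    show "AE \<omega> in M. (\<lambda>n. f (\<phi> t \<omega> (u n))) \<longlonglongrightarrow> f (\<phi> t \<omega> x)"
    proof (rule AE_I2)
      fix \<omega> assume "\<omega> \<in> space M"
      then have "(\<lambda>n. \<phi> t \<omega> (u n)) \<longlonglongrightarrow> \<phi> t \<omega> x"
        using continuous_on_tendsto_compose[OF \<phi>_continuous u] assms(1) by simp
      then show "(\<lambda>n. f (\<phi> t \<omega> (u n))) \<longlonglongrightarrow> f (\<phi> t \<omega> x)"
        using continuous_on_tendsto_compose[OF assms(2)] by simp
    qed
  qed (use assms measurable_F_M[OF assms(1) continuous_measurable_\<phi>[OF assms(1,2)]] in auto)
qed

text \<open>Chapman-Kolmogorov. By the cocycle law the state at time \<open>s + t\<close> is a
  function of the state at time \<open>s\<close>, which is past, and of the noise shifted by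
  \<open>s\<close>, which is independent of it and has law \<open>M_infty\<close>; Fubini integrates
  out the noise first.\<close>

lemma transition_add:
  assumes s: "s \<in> T" and t: "t \<in> T" and f: "continuous_on UNIV f" and b: "\<And>x. \<bar>f x\<bar> \<le> b"
  shows "transition (s + t) f x = transition s (transition t f) x"
proof -
  interpret N: prob_space M_infty by (rule prob_space_M_infty)
  define L where "L = distr M borel (\<lambda>\<omega>. \<phi> s \<omega> x)"
  interpret L: prob_space L
    unfolding L_def by (rule prob_space_distr[OF \<phi>_measurable_M[OF s]])
  interpret LN: pair_prob_space L M_infty ..
  have sets_L: "sets L = sets borel" by (simp add: L_def)
  \<comment> \<open>State first and noise second, to match the order (past, future) in
    \<open>distr_past_future\<close>.\<close>
  define G where "G p = f (\<phi> t (snd p) (fst p))" for p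
  have "(\<lambda>p. \<phi> t (snd p) (fst p)) \<in> measurable (borel \<Otimes>\<^sub>M M_infty) borel"
    using measurable_compose[OF measurable_pair_swap' \<phi>_measurable_pair[OF t]]
    by (simp add: case_prod_beta)
  then have G: "G \<in> borel_measurable (borel \<Otimes>\<^sub>M M_infty)"
    unfolding G_def by (rule measurable_compose[OF _ borel_measurable_continuous_onI[OF f]])
  then have G': "G \<in> borel_measurable (L \<Otimes>\<^sub>M M_infty)"
    by (simp cong: measurable_cong_sets add: sets_pair_measure_cong[OF sets_L refl])
  have int: "integrable (L \<Otimes>\<^sub>M M_infty) G"
    using b G' by (intro LN.P.integrable_const_bound[of _ b]) (auto simp: G_def)
  have joint: "(\<lambda>\<omega>. (\<phi> s \<omega> x, \<theta> s \<omega>)) \<in> measurable M (borel \<Otimes>\<^sub>M M_infty)"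
    by (rule measurable_Pair[OF \<phi>_measurable_M[OF s] \<theta>_measurable_M_M_infty[OF s]])
  have "transition (s + t) f x = (\<integral>\<omega>. G (\<phi> s \<omega> x, \<theta> s \<omega>) \<partial>M)"
    unfolding transition_def G_def
    by (rule Bochner_Integration.integral_cong) (simp_all add: \<phi>_cocycle[OF s t])
  also have "\<dots> = (\<integral>p. G p \<partial>distr M (borel \<Otimes>\<^sub>M M_infty) (\<lambda>\<omega>. (\<phi> s \<omega> x, \<theta> s \<omega>)))"
    by (rule integral_distr[OF joint G, symmetric])
  also have "\<dots> = (\<integral>p. G p \<partial>(L \<Otimes>\<^sub>M M_infty))"
    unfolding L_def by (simp add: distr_past_future[OF s \<phi>_measurable_F[OF s]])
  also have "\<dots> = (\<integral>y. (\<integral>\<omega>. G (y, \<omega>) \<partial>M_infty) \<partial>L)"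
    by (rule LN.integral_fst'[OF int, symmetric])
  also have "\<dots> = (\<integral>y. transition t f y \<partial>L)"
  proof (rule Bochner_Integration.integral_cong[OF refl])
    fix y
    \<comment> \<open>The integrand is measurable for \<open>F_infty M T F\<close>, so
      \<open>M_infty\<close> and \<open>M\<close> give it the same integral.\<close>
    have "(\<lambda>\<omega>. f (\<phi> t \<omega> y)) \<in> borel_measurable (F_infty M T F)"
      using measurable_in_subalg'[OF subalgebra_F_infty measurable_F_M_infty[OF t continuous_measurable_\<phi>[OF t f]]] .
    then show "(\<integral>\<omega>. G (y, \<omega>) \<partial>M_infty) = transition t f y"
      by (simp add: G_def transition_def integral_subalgebra2[OF subalgebra_F_infty])
  qed
  also have "\<dots> = (\<integral>\<omega>. transition t f (\<phi> s \<omega> x) \<partial>M)"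
    unfolding L_def
    by (rule integral_distr[OF \<phi>_measurable_M[OF s] borel_measurable_continuous_onI[OF transition_continuous[OF t f b]]])
  finally show ?thesis
    by (simp add: transition_def)
qed

text \<open>Fubini with the noise innermost. This ties the state component of the skew product to
  the transition operator.\<close>

lemma transition_pair_integral:
  assumes \<rho>: "prob_space \<rho>" "sets \<rho> = sets borel" and t: "t \<in> T"
    and f: "continuous_on UNIV f" and b: "\<And>x. \<bar>f x\<bar> \<le> b"
  shows "(\<integral>p. f (\<phi> t (fst p) (snd p)) \<partial>(M_infty \<Otimes>\<^sub>M \<rho>)) = (\<integral>x. transition t f x \<partial>\<rho>)"
proof -
  interpret N: prob_space M_infty by (rule prob_space_M_infty)
  interpret \<rho>: prob_space \<rho> by fact
  interpret N\<rho>: pair_prob_space M_infty \<rho> ..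
  have "(\<lambda>p. f (\<phi> t (fst p) (snd p))) \<in> borel_measurable (M_infty \<Otimes>\<^sub>M borel)"
    by (rule measurable_compose[OF \<phi>_measurable_pair[OF t] borel_measurable_continuous_onI[OF f]])
  then have meas: "(\<lambda>p. f (\<phi> t (fst p) (snd p))) \<in> borel_measurable (M_infty \<Otimes>\<^sub>M \<rho>)"
    by (simp cong: measurable_cong_sets add: sets_pair_measure_cong[OF refl \<rho>(2)])
  have "integrable (M_infty \<Otimes>\<^sub>M \<rho>) (\<lambda>(\<omega>, x). f (\<phi> t \<omega> x))"
    using b meas by (intro N\<rho>.P.integrable_const_bound[of _ b]) (auto simp: case_prod_beta)
  then have "(\<integral>x. (\<integral>\<omega>. f (\<phi> t \<omega> x) \<partial>M_infty) \<partial>\<rho>) = (\<integral>p. f (\<phi> t (fst p) (snd p)) \<partial>(M_infty \<Otimes>\<^sub>M \<rho>))"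
    by (subst N\<rho>.integral_snd) (simp_all add: case_prod_beta')
  moreover have "(\<integral>\<omega>. f (\<phi> t \<omega> x) \<partial>M_infty) = transition t f x" for x
    unfolding transition_def
    by (rule integral_subalgebra2[OF subalgebra_F_infty
      measurable_in_subalg'[OF subalgebra_F_infty measurable_F_M_infty[OF t continuous_measurable_\<phi>[OF t f]]]])
  ultimately show ?thesis by simp
qed

text \<open>Invariance of the product measure is tested on functions of the state alone.\<close>

lemma stationary_imp_transition_invariant:
  assumes "stationary M T F \<theta> \<phi> \<rho>" and t: "t \<in> T"
    and f: "continuous_on UNIV f" and b: "\<And>x. \<bar>f x\<bar> \<le> b"
  shows "(\<integral>x. transition t f x \<partial>\<rho>) = (\<integral>x. f x \<partial>\<rho>)"
proof -
  have \<rho>: "prob_space \<rho>" "sets \<rho> = sets borel"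
    and inv: "invariant_under (M_infty \<Otimes>\<^sub>M \<rho>) (skew_product \<theta> \<phi> t)"
    using assms(1) t by (simp_all add: stationary_def)
  interpret N: prob_space M_infty by (rule prob_space_M_infty)
  interpret \<rho>: prob_space \<rho> by fact
  interpret N\<rho>: pair_prob_space M_infty \<rho> ..
  let ?Q = "M_infty \<Otimes>\<^sub>M \<rho>"
  have f_meas: "f \<in> borel_measurable \<rho>"
    using borel_measurable_continuous_onI[OF f] by (simp cong: measurable_cong_sets[OF \<rho>(2) refl])
  have f_snd: "(\<lambda>p. f (snd p)) \<in> borel_measurable ?Q"
    by (rule measurable_compose[OF measurable_snd f_meas])
  have "(\<integral>x. transition t f x \<partial>\<rho>) = (\<integral>p. f (snd (skew_product \<theta> \<phi> t p)) \<partial>?Q)"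
    unfolding transition_pair_integral[OF \<rho> t f b, symmetric]
    by (simp add: skew_product_def case_prod_beta)
  also have "\<dots> = (\<integral>p. f (snd p) \<partial>distr ?Q ?Q (skew_product \<theta> \<phi> t))"
    using inv by (intro integral_distr[OF _ f_snd, symmetric]) (simp add: invariant_under_def)
  also have "\<dots> = (\<integral>p. f (snd p) \<partial>?Q)"
    using inv by (simp add: invariant_under_def)
  also have "\<dots> = (\<integral>x. f x \<partial>\<rho>)"
  proof -
    have "integrable ?Q (\<lambda>(\<omega>, x). f x)"
      using b f_snd by (intro N\<rho>.P.integrable_const_bound[of _ b]) (auto simp: case_prod_beta)
    then have "(\<integral>x. (\<integral>\<omega>. f x \<partial>M_infty) \<partial>\<rho>) = (\<integral>p. f (snd p) \<partial>?Q)"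
      by (subst N\<rho>.integral_snd) (simp_all add: case_prod_beta')
    then show ?thesis by (simp add: N.prob_space)
  qed
  finally show ?thesis .
qed

section \<open>Consequences of synchronisation\<close>

text \<open>The trajectories approach each other without necessarily converging, so uniform
  continuity of \<open>f\<close> is what makes the differences of values tend to 0; these are
  dominated by \<open>2 * b\<close>.\<close>

lemma synchronising_transition_diff:
  assumes sync: "synchronising M T \<phi>" and f: "uniformly_continuous_on UNIV f" and b: "\<And>x. \<bar>f x\<bar> \<le> b"
  shows "(\<lambda>n. transition (real n) f x - transition (real n) f y) \<longlonglongrightarrow> 0"
proof -
  have cont: "continuous_on UNIV f"
    using f by (rule uniformly_continuous_imp_continuous)
  have meas: "(\<lambda>\<omega>. f (\<phi> (real n) \<omega> z)) \<in> borel_measurable M" for n z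
    by (rule measurable_F_M[OF of_nat_in_T continuous_measurable_\<phi>[OF of_nat_in_T cont]])
  have int: "integrable M (\<lambda>\<omega>. f (\<phi> (real n) \<omega> z))" for n z
    using b meas by (intro integrable_const_bound[of _ b]) auto
  let ?S = "{\<omega> \<in> space M. ((\<lambda>t. dist (\<phi> t \<omega> x) (\<phi> t \<omega> y)) \<longlongrightarrow> 0) (inf at_top (principal T))}"
  have prob: "prob ?S = 1"
    using sync by (simp add: synchronising_def)
  \<comment> \<open>A non-measurable set has \<open>measure\<close> 0 by convention, so the value 1
    forces measurability.\<close>
  then have "?S \<in> events"
    using measure_notin_sets[of ?S M] by (cases "?S \<in> events") simp_all
  then have in_S: "AE \<omega> in M. \<omega> \<in> ?S"
    using prob by (simp add: prob_eq_1)
  have subseq: "filterlim real (inf at_top (principal T)) sequentially"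
    using filterlim_real_sequentially of_nat_in_T by (simp add: filterlim_inf filterlim_principal)
  from in_S have conv: "AE \<omega> in M. (\<lambda>n. f (\<phi> (real n) \<omega> x) - f (\<phi> (real n) \<omega> y)) \<longlonglongrightarrow> 0"
  proof eventually_elim
    case (elim \<omega>)
    then have "(\<lambda>n. dist (\<phi> (real n) \<omega> x) (\<phi> (real n) \<omega> y)) \<longlonglongrightarrow> 0"
      using filterlim_compose[OF _ subseq] by blast
    then have "(\<lambda>n. dist (f (\<phi> (real n) \<omega> x)) (f (\<phi> (real n) \<omega> y))) \<longlonglongrightarrow> 0"
      using f[unfolded uniformly_continuous_on_sequentially, rule_format,
          of "\<lambda>n. \<phi> (real n) \<omega> x" "\<lambda>n. \<phi> (real n) \<omega> y"] by simp
    then show ?case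
      by (simp add: dist_real_def tendsto_rabs_zero_iff)
  qed
  have "(\<lambda>n. \<integral>\<omega>. f (\<phi> (real n) \<omega> x) - f (\<phi> (real n) \<omega> y) \<partial>M) \<longlonglongrightarrow> (\<integral>\<omega>. 0 \<partial>M)"
  proof (rule integral_dominated_convergence[where w="\<lambda>_. 2 * b"])
    show "AE \<omega> in M. norm (f (\<phi> (real n) \<omega> x) - f (\<phi> (real n) \<omega> y)) \<le> 2 * b" for n
    proof (rule AE_I2)
      fix \<omega>
      show "norm (f (\<phi> (real n) \<omega> x) - f (\<phi> (real n) \<omega> y)) \<le> 2 * b"
        using b[of "\<phi> (real n) \<omega> x"] b[of "\<phi> (real n) \<omega> y"] by (simp add: abs_le_iff)
    qed
  qed (use meas conv in auto)
  then show ?thesis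
    by (simp add: transition_def int)
qed

text \<open>The initial point may be random. Existence uses \<open>Y\<close> as the state at time
  \<open>t\<close>, uniqueness uses \<open>Y\<close> as the identity under a stationary
  measure.\<close>

lemma synchronising_transition_tendsto:
  assumes sync: "synchronising M T \<phi>" and f: "uniformly_continuous_on UNIV f" and b: "\<And>x. \<bar>f x\<bar> \<le> b"
    and N: "prob_space N" and Y: "Y \<in> borel_measurable N"
  shows "(\<lambda>n. (\<integral>u. transition (real n) f (Y u) \<partial>N) - transition (real n) f x) \<longlonglongrightarrow> 0"
proof -
  interpret N: prob_space N by fact
  have cont: "continuous_on UNIV f"
    using f by (rule uniformly_continuous_imp_continuous)
  have bound: "\<bar>transition (real n) f y\<bar> \<le> b" for n y
    by (rule transition_bounded[OF of_nat_in_T cont b])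
  have meas: "(\<lambda>u. transition (real n) f (Y u)) \<in> borel_measurable N" for n
    by (rule measurable_compose[OF Y borel_measurable_continuous_onI[OF transition_continuous[OF of_nat_in_T cont b]]])
  have int: "integrable N (\<lambda>u. transition (real n) f (Y u))" for n
    using bound meas by (intro N.integrable_const_bound[of _ b]) auto
  have "(\<lambda>n. \<integral>u. transition (real n) f (Y u) - transition (real n) f x \<partial>N) \<longlonglongrightarrow> (\<integral>u. 0 \<partial>N)"
  proof (rule integral_dominated_convergence[where w="\<lambda>_. 2 * b"])
    show "AE u in N. norm (transition (real n) f (Y u) - transition (real n) f x) \<le> 2 * b" for n
    proof (rule AE_I2)
      fix u
      show "norm (transition (real n) f (Y u) - transition (real n) f x) \<le> 2 * b"
        using bound[of n "Y u"] bound[of n x] by (simp add: abs_le_iff)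
    qed
  qed (use meas synchronising_transition_diff[OF sync f b] in auto)
  then show ?thesis
    using int N.prob_space by simp
qed


section \<open>Stationarity from invariance under the transition operators\<close>

lemma skew_product_measurable:
  assumes t: "t \<in> T" and \<rho>: "sets \<rho> = sets borel"
  shows "skew_product \<theta> \<phi> t \<in> measurable (M_infty \<Otimes>\<^sub>M \<rho>) (M_infty \<Otimes>\<^sub>M \<rho>)"
proof -
  have "(\<lambda>p. (\<theta> t (fst p), \<phi> t (fst p) (snd p))) \<in> measurable (M_infty \<Otimes>\<^sub>M borel) (M_infty \<Otimes>\<^sub>M borel)"
    by (intro measurable_Pair \<phi>_measurable_pair[OF t] measurable_compose[OF measurable_fst \<theta>_measurable_M_infty[OF t]])
  then show ?thesis
    by (simp add: skew_product_def case_prod_beta' sets_pair_measure_cong[OF refl \<rho>] cong: measurable_cong_sets)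
qed

text \<open>Invariance first shows that the state at time \<open>t\<close> has law
  \<open>\<rho>\<close>. On a rectangle, for each fixed initial point, the state event is past and
  the noise event is future; independence pulls the noise factor out of the integral over initial
  points.\<close>

lemma transition_invariant_imp_stationary:
  assumes \<rho>: "prob_space \<rho>" "sets \<rho> = sets borel"
    and inv: "\<And>t f. t \<in> T \<Longrightarrow> continuous_on UNIV f \<Longrightarrow> (\<And>x. \<bar>f x\<bar> \<le> 1) \<Longrightarrow>
      (\<integral>x. transition t f x \<partial>\<rho>) = (\<integral>x. f x \<partial>\<rho>)"
  shows "stationary M T F \<theta> \<phi> \<rho>"
  unfolding stationary_def invariant_under_def
proof (intro conjI ballI)
  fix t assume t: "t \<in> T"
  let ?Q = "M_infty \<Otimes>\<^sub>M \<rho>" and ?\<Theta> = "skew_product \<theta> \<phi> t"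
  interpret N: prob_space M_infty by (rule prob_space_M_infty)
  interpret \<rho>: prob_space \<rho> by fact
  interpret N\<rho>: pair_prob_space M_infty \<rho> ..
  show meas: "?\<Theta> \<in> measurable ?Q ?Q"
    by (rule skew_product_measurable[OF t \<rho>(2)])
  have \<phi>_meas: "(\<lambda>p. \<phi> t (fst p) (snd p)) \<in> measurable ?Q borel"
    using \<phi>_measurable_pair[OF t]
    by (simp add: sets_pair_measure_cong[OF refl \<rho>(2)] cong: measurable_cong_sets)
  have distr_\<phi>: "distr ?Q borel (\<lambda>p. \<phi> t (fst p) (snd p)) = \<rho>"
  proof (rule measure_eqI_continuous)
    show "prob_space (distr ?Q borel (\<lambda>p. \<phi> t (fst p) (snd p)))"
      by (rule N\<rho>.P.prob_space_distr[OF \<phi>_meas])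
    fix f :: "'x \<Rightarrow> real" assume f: "continuous_on UNIV f" and "\<And>x. 0 \<le> f x" "\<And>x. f x \<le> 1"
    then have b: "\<bar>f x\<bar> \<le> 1" for x by simp
    show "(\<integral>x. f x \<partial>distr ?Q borel (\<lambda>p. \<phi> t (fst p) (snd p))) = (\<integral>x. f x \<partial>\<rho>)"
      by (simp add: integral_distr[OF \<phi>_meas borel_measurable_continuous_onI[OF f]]
          transition_pair_integral[OF \<rho> t f b] inv[OF t f b])
  qed (simp_all add: \<rho>)
  have "?Q = distr ?Q ?Q ?\<Theta>"
  proof (rule pair_measure_eqI)
    fix E B assume E: "E \<in> sets M_infty" and B: "B \<in> sets \<rho>"
    have B': "B \<in> sets borel" using B \<rho>(2) by simp
    have EB: "E \<times> B \<in> sets ?Q" using E B by simp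
    \<comment> \<open>For a fixed initial point, the pulled-back rectangle is the intersection of a
      past event and a shifted event.\<close>
    have section_E: "(\<lambda>\<omega>. (\<omega>, x)) -` (?\<Theta> -` (E \<times> B) \<inter> space ?Q)
        = ((\<lambda>\<omega>. \<phi> t \<omega> x) -` B \<inter> space M) \<inter> (\<theta> t -` E \<inter> space M)" if "x \<in> space \<rho>" for x
      using that by (auto simp: skew_product_def space_pair_measure space_M_infty)
    have section_\<phi>: "(\<lambda>\<omega>. (\<omega>, x)) -` ((\<lambda>p. \<phi> t (fst p) (snd p)) -` B \<inter> space ?Q)
        = (\<lambda>\<omega>. \<phi> t \<omega> x) -` B \<inter> space M" if "x \<in> space \<rho>" for x
      using that by (auto simp: space_pair_measure space_M_infty)
    have past: "(\<lambda>\<omega>. \<phi> t \<omega> x) -` B \<inter> space M \<in> sets (F t)" for x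
      using measurable_sets[OF \<phi>_measurable_F[OF t] B'] subalgebra_F[OF t] by (simp add: subalgebra_def)
    have past_M: "emeasure M_infty ((\<lambda>\<omega>. \<phi> t \<omega> x) -` B \<inter> space M) = emeasure M ((\<lambda>\<omega>. \<phi> t \<omega> x) -` B \<inter> space M)" for x
      using past sets_F_subset_M_infty[OF t] by (intro emeasure_M_infty) blast
    have future: "\<theta> t -` E \<inter> space M \<in> sets M_infty"
      using measurable_sets[OF \<theta>_measurable_M_infty[OF t] E] by (simp add: space_M_infty)
    have both: "emeasure M_infty (((\<lambda>\<omega>. \<phi> t \<omega> x) -` B \<inter> space M) \<inter> (\<theta> t -` E \<inter> space M))
        = emeasure M_infty E * emeasure M_infty ((\<lambda>\<omega>. \<phi> t \<omega> x) -` B \<inter> space M)" for x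
    proof -
      have "((\<lambda>\<omega>. \<phi> t \<omega> x) -` B \<inter> space M) \<inter> (\<theta> t -` E \<inter> space M) \<in> sets M_infty"
        by (rule sets.Int[OF subsetD[OF sets_F_subset_M_infty[OF t] past] future])
      then have "emeasure M_infty (((\<lambda>\<omega>. \<phi> t \<omega> x) -` B \<inter> space M) \<inter> (\<theta> t -` E \<inter> space M))
          = emeasure M (((\<lambda>\<omega>. \<phi> t \<omega> x) -` B \<inter> space M) \<inter> (\<theta> t -` E \<inter> space M))"
        by (rule emeasure_M_infty)
      also have "\<dots> = emeasure M ((\<lambda>\<omega>. \<phi> t \<omega> x) -` B \<inter> space M) * emeasure M_infty E"
        by (rule prob_past_future[OF t past E])
      finally show ?thesis
        by (simp only: past_M mult.commute)
    qed
    have "emeasure (distr ?Q ?Q ?\<Theta>) (E \<times> B)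
        = (\<integral>\<^sup>+x. emeasure M_infty ((\<lambda>\<omega>. (\<omega>, x)) -` (?\<Theta> -` (E \<times> B) \<inter> space ?Q)) \<partial>\<rho>)"
      by (simp only: emeasure_distr[OF meas EB] N\<rho>.emeasure_pair_measure_alt2[OF measurable_sets[OF meas EB]])
    also have "\<dots> = (\<integral>\<^sup>+x. emeasure M_infty E *
        emeasure M_infty ((\<lambda>\<omega>. (\<omega>, x)) -` ((\<lambda>p. \<phi> t (fst p) (snd p)) -` B \<inter> space ?Q)) \<partial>\<rho>)"
      by (rule nn_integral_cong) (simp only: section_E section_\<phi> both)
    also have "\<dots> = emeasure M_infty E *
        (\<integral>\<^sup>+x. emeasure M_infty ((\<lambda>\<omega>. (\<omega>, x)) -` ((\<lambda>p. \<phi> t (fst p) (snd p)) -` B \<inter> space ?Q)) \<partial>\<rho>)"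
      by (rule nn_integral_cmult[OF N\<rho>.measurable_emeasure_Pair2[OF measurable_sets[OF \<phi>_meas B']]])
    also have "\<dots> = emeasure M_infty E * emeasure (distr ?Q borel (\<lambda>p. \<phi> t (fst p) (snd p))) B"
      by (simp only: emeasure_distr[OF \<phi>_meas B'] N\<rho>.emeasure_pair_measure_alt2[OF measurable_sets[OF \<phi>_meas B']])
    finally show "emeasure M_infty E * emeasure \<rho> B = emeasure (distr ?Q ?Q ?\<Theta>) (E \<times> B)"
      by (simp only: distr_\<phi>)
  qed (simp_all add: N.sigma_finite_measure_axioms \<rho>.sigma_finite_measure_axioms)
  then show "distr ?Q ?Q ?\<Theta> = ?Q" by simp
qed (simp_all add: \<rho>)

section \<open>Existence and uniqueness of the stationary measure\<close>

lemma synchronising_imp_stationary_exists: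
  assumes compact: "compact (UNIV :: 'x set)" and sync: "synchronising M T \<phi>"
  shows "\<exists>\<rho>. stationary M T F \<theta> \<phi> \<rho>"
proof -
  fix x0 :: 'x
  define \<mu> where "\<mu> n = distr M borel (\<lambda>\<omega>. \<phi> (real n) \<omega> x0)" for n
  have "prob_space (\<mu> n)" "sets (\<mu> n) = sets borel" for n
    unfolding \<mu>_def by (simp_all add: prob_space_distr[OF \<phi>_measurable_M[OF of_nat_in_T]])
  then obtain s \<rho> where s: "strict_mono s" and \<rho>: "prob_space \<rho>" "sets \<rho> = sets borel"
    and lim: "\<And>f :: 'x \<Rightarrow> real. continuous_on UNIV f \<Longrightarrow> (\<lambda>n. \<integral>x. f x \<partial>\<mu> (s n)) \<longlonglongrightarrow> (\<integral>x. f x \<partial>\<rho>)"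
    using compact_metric_weak_subsequence[OF compact, of \<mu>] by blast
  have \<mu>: "(\<integral>x. f x \<partial>\<mu> n) = transition (real n) f x0" if "continuous_on UNIV f" for f n
    unfolding \<mu>_def transition_def
    by (rule integral_distr[OF \<phi>_measurable_M[OF of_nat_in_T] borel_measurable_continuous_onI[OF that]])
  have "stationary M T F \<theta> \<phi> \<rho>"
  proof (rule transition_invariant_imp_stationary[OF \<rho>])
    fix t and f :: "'x \<Rightarrow> real" assume t: "t \<in> T" and f: "continuous_on UNIV f" and b: "\<And>x. \<bar>f x\<bar> \<le> 1"
    have uc: "uniformly_continuous_on UNIV f"
      by (rule compact_uniformly_continuous[OF f compact])
    \<comment> \<open>The semigroup law is used in both orders: time \<open>n\<close> followed by
      \<open>t\<close>, and time \<open>t\<close> followed by \<open>n\<close>.\<close>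
    have "transition (real n) (transition t f) x0 = (\<integral>\<omega>. transition (real n) f (\<phi> t \<omega> x0) \<partial>M)" for n
      using transition_add[OF of_nat_in_T t f b, of n x0] transition_add[OF t of_nat_in_T f b, of n x0]
      by (simp add: add.commute transition_def[of t "transition (real n) f"])
    then have "(\<lambda>n. transition (real n) (transition t f) x0 - transition (real n) f x0) \<longlonglongrightarrow> 0"
      using synchronising_transition_tendsto[OF sync uc b prob_space_axioms \<phi>_measurable_M[OF t], of x0 x0] by simp
    from LIMSEQ_subseq_LIMSEQ[OF this s]
    \<comment> \<open>By the Feller property \<open>transition t f\<close> is itself a continuous
      test function, so weak convergence applies to both integrals.\<close>
    have "(\<lambda>n. (\<integral>x. transition t f x \<partial>\<mu> (s n)) - (\<integral>x. f x \<partial>\<mu> (s n))) \<longlonglongrightarrow> 0"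
      by (simp add: comp_def \<mu> f transition_continuous[OF t f b])
    moreover have "(\<lambda>n. (\<integral>x. transition t f x \<partial>\<mu> (s n)) - (\<integral>x. f x \<partial>\<mu> (s n)))
        \<longlonglongrightarrow> (\<integral>x. transition t f x \<partial>\<rho>) - (\<integral>x. f x \<partial>\<rho>)"
      by (intro tendsto_diff lim f transition_continuous[OF t f b])
    ultimately have "0 = (\<integral>x. transition t f x \<partial>\<rho>) - (\<integral>x. f x \<partial>\<rho>)"
      by (rule LIMSEQ_unique)
    then show "(\<integral>x. transition t f x \<partial>\<rho>) = (\<integral>x. f x \<partial>\<rho>)" by simp
  qed
  then show ?thesis ..
qed

lemma synchronising_stationary_unique:
  assumes compact: "compact (UNIV :: 'x set)" and sync: "synchronising M T \<phi>"
    and \<rho>: "stationary M T F \<theta> \<phi> \<rho>" and \<rho>': "stationary M T F \<theta> \<phi> \<rho>'"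
  shows "\<rho> = \<rho>'"
proof (rule measure_eqI_continuous)
  fix x0 :: 'x and f :: "'x \<Rightarrow> real"
  assume f: "continuous_on UNIV f" and "\<And>x. 0 \<le> f x" "\<And>x. f x \<le> 1"
  then have b: "\<bar>f x\<bar> \<le> 1" for x by simp
  have uc: "uniformly_continuous_on UNIV f"
    by (rule compact_uniformly_continuous[OF f compact])
  \<comment> \<open>Stationarity makes the integral of \<open>transition (real n) f\<close> against
    \<open>N\<close> independent of \<open>n\<close>, while synchronisation compares it with the
    value at \<open>x0\<close>, which does not involve \<open>N\<close>.\<close>
  have "(\<lambda>n. (\<integral>x. f x \<partial>N) - transition (real n) f x0) \<longlonglongrightarrow> 0" if N: "stationary M T F \<theta> \<phi> N" for N
  proof -
    have "prob_space N" "(\<lambda>x. x) \<in> borel_measurable N"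
      using N by (simp_all add: stationary_def measurable_ident_sets)
    from synchronising_transition_tendsto[OF sync uc b this, of x0] show ?thesis
      by (simp add: stationary_imp_transition_invariant[OF N of_nat_in_T f b])
  qed
  \<comment> \<open>The terms at \<open>x0\<close> cancel, leaving a constant sequence with limit
    0.\<close>
  from tendsto_diff[OF this[OF \<rho>] this[OF \<rho>']] show "(\<integral>x. f x \<partial>\<rho>) = (\<integral>x. f x \<partial>\<rho>')"
    by (simp add: LIMSEQ_const_iff)
qed (use \<rho> \<rho>' in \<open>simp_all add: stationary_def\<close>)

end

theorem proposition2p1p4:
  fixes M :: "'w measure" and T :: "real set"
    and F :: "real \<Rightarrow> 'w measure" and \<theta> :: "real \<Rightarrow> 'w \<Rightarrow> 'w"
    and \<phi> :: "real \<Rightarrow> 'w \<Rightarrow> 'x::metric_space \<Rightarrow> 'x"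
  assumes "compact (UNIV :: 'x set)"
    and "random_dynamical_system M T F \<theta> \<phi>"
    and "synchronising M T \<phi>"
  shows "uniquely_ergodic M T F \<theta> \<phi>"
proof -
  interpret random_dynamical_system M T F \<theta> \<phi> by fact
  show ?thesis
    unfolding uniquely_ergodic_def
    using synchronising_imp_stationary_exists[OF assms(1,3)] synchronising_stationary_unique[OF assms(1,3)]
    by blast
qed

end
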